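(* Let $p>1$ and let $f,g,\rho,d$ satisfy the standing assumptions. Assume that the limit $$\ell_1:=\lim_{u\to1^-}\rho(u)\left(\frac{d(u)}{1-u}\right)^{\frac1{p-1}}\in[0,+\infty]$$ exists. Let $u$ be a traveling wave solution with some speed $c$, defined in the interval $(\alpha,\beta)$. Then: - if $\liminf_{u\to1^-}d(u)>0$, then $\lim_{t\to\alpha^+}u'(t)=0$; - if $d(1^-)=0$, $\dot d(1)=-\infty$ and $\ell_1<+\infty$, then $\lim_{t\to\alpha^+}u'(t)=0$; - if $d(1^-)=0$ and $-\infty<\dot d(1)<0$, then $$\lim_{t\to\alpha^+}u'(t)=-\left(\max\left\{0,\frac{cg(1)-f(1)}{\dot d(1)}\right\}\right)^{\frac1{p-1}};$$ - if $d(1^-)=0$, $\lim_{u\to1^-}\dot d(u)=0$ and $cg(1)-f(1)\ne0$, then $$\lim_{t\to\alpha^+}u'(t)=\begin{cases}0&\text{if }cg(1)-f(1)>0\\-\infty&\text{if }cg(1)-f(1)<0.\end{cases}$$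
   Context: Standing assumptions: $p>1$; $f,g,\rho\in C[0,1]$; $d\in C^1(0,1)$; $\rho(u)>0$ in $(0,1)$ and $\rho(0)=\rho(1)=0$; $g(0)>0$ and $\int_0^u g(s)\,ds>0$ for every $u\in(0,1]$; $d(u)>0$ in $(0,1)$ and $\rho\, d^{\frac1{p-1}}\in L^1(0,1)$. A traveling wave solution (t.w.s.) with speed $c\in\mathbb R$ is a function $u\in C^1(\alpha,\beta)$, with $-\infty\le\alpha<\beta\le+\infty$, such that $0<u(t)<1$ for all $t\in(\alpha,\beta)$, $d(u)|u'|^{p-2}u'\in C^1(\alpha,\beta)$, $$(d(u)|u'|^{p-2}u')'+(cg(u)-f(u))u'+\rho(u)=0\quad\text{in }(\alpha,\beta),$$ $u(\alpha^+)=1$, $u(\beta^-)=0$, and $\lim_{t\to\alpha^+}d(u)|u'|^{p-2}u'=\lim_{t\to\beta^-}d(u)|u'|^{p-2}u'=0$. Notation: $d(1^-)=\lim_{u\to1^-}d(u)$; $\dot d(u)$ is the derivative of $d$ at $u\in(0,1)$; $\dot d(1):=\lim_{u\to1^-}\frac{-d(u)}{1-u}$, possibly infinite (a hypothesis on $\dot d(1)$ includes that this limit exists). *)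

theory Defs
  imports "HOL-Analysis.Analysis"
begin

text \<open>
  Endpoints \<open>\<alpha>\<close>, \<open>\<beta>\<close> of the wave interval are extended reals, and one-sided limits at them are
  taken as in the interval-integral library: \<open>((h \<circ> real_of_ereal) \<longlongrightarrow> L) (at_right \<alpha>)\<close>, with
  \<open>at_right\<close> on \<^typ>\<open>ereal\<close>; this is the limit at \<open>-\<infinity>\<close> when \<open>\<alpha> = -\<infinity>\<close>.
\<close>

definition standing_assumptions ::
  "real \<Rightarrow> (real \<Rightarrow> real) \<Rightarrow> (real \<Rightarrow> real) \<Rightarrow> (real \<Rightarrow> real) \<Rightarrow> (real \<Rightarrow> real) \<Rightarrow> bool" where
  "standing_assumptions p f g \<rho> d \<longleftrightarrow>
     p > 1 \<and>
     continuous_on {0..1} f \<and> continuous_on {0..1} g \<and> continuous_on {0..1} \<rho> \<and>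
     d C1_differentiable_on {0<..<1} \<and>
     (\<forall>u\<in>{0<..<1}. \<rho> u > 0) \<and> \<rho> 0 = 0 \<and> \<rho> 1 = 0 \<and>
     g 0 > 0 \<and> (\<forall>u\<in>{0<..1}. integral {0..u} g > 0) \<and>
     (\<forall>u\<in>{0<..<1}. d u > 0) \<and>
     set_integrable lborel {0<..<1} (\<lambda>u. \<rho> u * d u powr (1 / (p - 1)))"

text \<open>
  The term \<open>d(u) |u'|\<^sup>p\<^sup>-\<^sup>2 u'\<close>. Where \<open>u' = 0\<close> it is \<open>0\<close> for every \<open>p > 1\<close>, also for \<open>p < 2\<close>.
\<close>

definition p_flux :: "real \<Rightarrow> (real \<Rightarrow> real) \<Rightarrow> (real \<Rightarrow> real) \<Rightarrow> real \<Rightarrow> real" where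
  "p_flux p d u t = d (u t) * \<bar>deriv u t\<bar> powr (p - 2) * deriv u t"

definition traveling_wave ::
  "real \<Rightarrow> (real \<Rightarrow> real) \<Rightarrow> (real \<Rightarrow> real) \<Rightarrow> (real \<Rightarrow> real) \<Rightarrow> (real \<Rightarrow> real) \<Rightarrow>
   real \<Rightarrow> ereal \<Rightarrow> ereal \<Rightarrow> (real \<Rightarrow> real) \<Rightarrow> bool" where
  "traveling_wave p f g \<rho> d c \<alpha> \<beta> u \<longleftrightarrow>
     \<alpha> < \<beta> \<and>
     u C1_differentiable_on (einterval \<alpha> \<beta>) \<and>
     (\<forall>t\<in>einterval \<alpha> \<beta>. 0 < u t \<and> u t < 1) \<and>
     p_flux p d u C1_differentiable_on (einterval \<alpha> \<beta>) \<and>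
     (\<forall>t\<in>einterval \<alpha> \<beta>.
        deriv (p_flux p d u) t + (c * g (u t) - f (u t)) * deriv u t + \<rho> (u t) = 0) \<and>
     ((u \<circ> real_of_ereal) \<longlongrightarrow> 1) (at_right \<alpha>) \<and>
     ((u \<circ> real_of_ereal) \<longlongrightarrow> 0) (at_left \<beta>) \<and>
     ((p_flux p d u \<circ> real_of_ereal) \<longlongrightarrow> 0) (at_right \<alpha>) \<and>
     ((p_flux p d u \<circ> real_of_ereal) \<longlongrightarrow> 0) (at_left \<beta>)"

text \<open>
  \<open>has_slope_at_1 d D\<close>: the possibly infinite limit \<open>lim\<^bsub>u\<rightarrow>1-\<^esub> -d(u) / (1 - u)\<close> exists and equals \<open>D\<close>.
  The value \<open>d 1\<close> itself is irrelevant.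
\<close>

definition has_slope_at_1 :: "(real \<Rightarrow> real) \<Rightarrow> ereal \<Rightarrow> bool" where
  "has_slope_at_1 d D \<longleftrightarrow> ((\<lambda>u. ereal (- d u / (1 - u))) \<longlongrightarrow> D) (at_left 1)"

end

theory Submission
  imports Defs "HOL-Real_Asymp.Real_Asymp"
begin

text \<open>
  Put \<open>h = c g - f\<close>. A wave is strictly decreasing, so \<open>y = - d(u) |u'|\<^sup>p\<^sup>-\<^sup>2 u'\<close> is positive,
  \<open>u' = - (y / d(u))\<^bsup>1/(p-1)\<^esup>\<close>, and as a function of \<open>v = u(t)\<close> it solves
  \<open>dy/dv = h(v) - \<rho>(v) (d(v) / y)\<^bsup>1/(p-1)\<^esup>\<close> with \<open>y \<rightarrow> 0\<close> as \<open>v \<rightarrow> 1\<close>. Everything reduces to the limit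
  of \<open>y / d\<close>. If \<open>b \<rightarrow> 0\<close> as \<open>v \<rightarrow> 1\<close>, then \<open>y \<le> b\<close> near \<open>1\<close> when
  \<open>b' < h - \<rho> (d / b)\<^bsup>1/(p-1)\<^esup>\<close>, and \<open>y \<ge> b\<close> near \<open>1\<close> when \<open>b' > h\<close>. The barriers
  \<open>b(v) = K (1 - v)\<close> settle the cases with nonzero slope of \<open>d\<close> at \<open>1\<close>, and \<open>b = K d\<close> those
  with \<open>d' \<rightarrow> 0\<close>. All comparisons are made in \<open>t\<close>, which avoids inverting \<open>u\<close>.
\<close>

section \<open>Limits at the left endpoint and a one-sided comparison principle\<close>

abbreviation left_end_filter :: "ereal \<Rightarrow> real filter" where
  "left_end_filter \<alpha> \<equiv> filtermap real_of_ereal (at_right \<alpha>)"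

text \<open>Pushing \<open>at_right \<alpha>\<close> forward to the reals treats finite
  \<open>\<alpha>\<close> and \<alpha> = -\<infinity> alike. The threshold becomes a real number
  \<open>s\<close> because a real lies between \<open>\<alpha>\<close> and the minimum of
  \<open>\<beta>\<close> and the given bound.\<close>

lemma eventually_left_end_filter:
  fixes \<alpha> \<beta> :: ereal
  assumes "\<alpha> < \<beta>"
  shows "eventually P (left_end_filter \<alpha>) \<longleftrightarrow> (\<exists>s\<in>einterval \<alpha> \<beta>. \<forall>t. \<alpha> < ereal t \<longrightarrow> t < s \<longrightarrow> P t)"
proof
  assume "eventually P (left_end_filter \<alpha>)"
  then obtain b where b: "b > \<alpha>" "\<And>y. \<alpha> < y \<Longrightarrow> y < b \<Longrightarrow> P (real_of_ereal y)"
    using assms by (auto simp: eventually_filtermap eventually_at_right)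
  obtain s where s: "\<alpha> < ereal s" "ereal s < min b \<beta>"
    using b(1) assms ereal_dense2[of \<alpha> "min b \<beta>"] by auto
  have "P t" if "\<alpha> < ereal t" "t < s" for t
    using b(2)[of "ereal t"] that s less_trans[of "ereal t" "ereal s" b] by simp
  then show "\<exists>s\<in>einterval \<alpha> \<beta>. \<forall>t. \<alpha> < ereal t \<longrightarrow> t < s \<longrightarrow> P t"
    using s by (auto simp: einterval_def)
next
  assume "\<exists>s\<in>einterval \<alpha> \<beta>. \<forall>t. \<alpha> < ereal t \<longrightarrow> t < s \<longrightarrow> P t"
  then obtain s where s: "\<alpha> < ereal s" "\<And>t. \<alpha> < ereal t \<Longrightarrow> t < s \<Longrightarrow> P t"
    by (auto simp: einterval_def)
  have "P (real_of_ereal y)" if "\<alpha> < y" "y < ereal s" for y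
    using that s(2) by (cases y) auto
  then show "eventually P (left_end_filter \<alpha>)"
    using assms s(1) by (auto simp: eventually_filtermap eventually_at_right)
qed

lemma left_end_filter_neq_bot:
  fixes \<alpha> \<beta> :: ereal
  assumes "\<alpha> < \<beta>"
  shows "left_end_filter \<alpha> \<noteq> bot"
proof -
  have "\<exists>t. \<alpha> < ereal t \<and> t < s" if "s \<in> einterval \<alpha> \<beta>" for s
    using that ereal_dense2[of \<alpha> "ereal s"] by (auto simp: einterval_def)
  then show ?thesis
    unfolding trivial_limit_def eventually_left_end_filter[OF assms] by blast
qed

text \<open>A positive value of \<open>\<phi>\<close> at \<open>t1\<close> would have to be reached
  from values near 0 on the left. After the last crossing of a positive level below it,
  \<open>\<phi>\<close> is positive and hence nonincreasing, so it cannot climb to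
  \<open>\<phi> t1\<close>.\<close>

lemma barrier_nonpos:
  fixes \<phi> \<phi>' :: "real \<Rightarrow> real" and \<alpha> \<beta> :: ereal
  assumes ab: "\<alpha> < \<beta>"
    and lim: "(\<phi> \<longlongrightarrow> 0) (left_end_filter \<alpha>)"
    and der: "\<forall>\<^sub>F t in left_end_filter \<alpha>. (\<phi> has_real_derivative \<phi>' t) (at t)"
    and sgn: "\<forall>\<^sub>F t in left_end_filter \<alpha>. 0 < \<phi> t \<longrightarrow> \<phi>' t \<le> 0"
  shows "\<forall>\<^sub>F t in left_end_filter \<alpha>. \<phi> t \<le> 0"
proof -
  from eventually_conj[OF der sgn] obtain s where s: "s \<in> einterval \<alpha> \<beta>"
    and D: "\<And>t. \<alpha> < ereal t \<Longrightarrow> t < s \<Longrightarrow> (\<phi> has_real_derivative \<phi>' t) (at t)"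
    and N: "\<And>t. \<alpha> < ereal t \<Longrightarrow> t < s \<Longrightarrow> 0 < \<phi> t \<Longrightarrow> \<phi>' t \<le> 0"
    unfolding eventually_left_end_filter[OF ab] by auto
  have "\<phi> t1 \<le> 0" if t1: "\<alpha> < ereal t1" "t1 < s" for t1
  proof (rule ccontr)
    assume "\<not> \<phi> t1 \<le> 0"
    \<comment> \<open>Any level strictly between 0 and \<open>\<phi> t1\<close> would do:
      \<open>\<phi>\<close> is below it near the left end, and above it the sign condition
      applies.\<close>
    define m where "m = \<phi> t1 / 2"
    with \<open>\<not> \<phi> t1 \<le> 0\<close> have m: "0 < m" "m < \<phi> t1" by auto
    have "\<forall>\<^sub>F t in left_end_filter \<alpha>. \<phi> t < m"
      using lim m(1) by (rule order_tendstoD)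
    moreover have "\<forall>\<^sub>F t in left_end_filter \<alpha>. \<alpha> < ereal t \<and> t < t1"
      using t1 by (subst eventually_left_end_filter[of \<alpha> "ereal s"])
        (auto simp: einterval_def intro: less_trans)
    ultimately obtain t2 where t2: "\<phi> t2 < m" "\<alpha> < ereal t2" "t2 < t1"
      using eventually_happens'[OF left_end_filter_neq_bot[OF ab] eventually_conj] by blast
    have in_range: "\<alpha> < ereal x" if "t2 \<le> x" for x
      using that t2(2) by (meson ereal_less_eq(3) less_le_trans)
    have cont: "continuous_on {t2..t1} \<phi>"
      using t1(2) by (intro DERIV_continuous_on[where D = \<phi>'] has_field_derivative_at_within[OF D])
        (auto intro: in_range)
    let ?S = "{x \<in> {t2..t1}. \<phi> x \<le> m}"
    have "closed ?S"
      using continuous_on_closed_Collect_le[OF cont continuous_on_const] by simp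
    then have "compact ?S"
      by (auto simp: compact_eq_bounded_closed intro: bounded_subset[of "{t2..t1}"])
    moreover have "t2 \<in> ?S" using t2 by auto
    then have "?S \<noteq> {}" by blast
    \<comment> \<open>\<open>r\<close> is the last point of the segment with
      \<open>\<phi> \<le> m\<close>, so \<open>\<phi> > m > 0\<close> on all of (r, t1].\<close>
    ultimately obtain r where r: "r \<in> ?S" "\<And>x. x \<in> ?S \<Longrightarrow> x \<le> r"
      using compact_attains_sup[of ?S] by blast
    have "r \<noteq> t1" using r(1) m(2) by auto
    then have rt: "r < t1" "t2 \<le> r" using r(1) by auto
    have "\<exists>z. r < z \<and> z < t1 \<and> \<phi> t1 - \<phi> r = (t1 - r) * \<phi>' z"
      using rt t1 by (intro MVT2 D) (auto intro: in_range)
    then obtain z where z: "r < z" "z < t1" "\<phi> t1 - \<phi> r = (t1 - r) * \<phi>' z" by blast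
    have "\<not> \<phi> z \<le> m" using r(2)[of z] z rt by auto
    then have "\<phi>' z \<le> 0" using m z rt t1 by (intro N in_range) auto
    then have "(t1 - r) * \<phi>' z \<le> 0" using rt by (simp add: mult_nonneg_nonpos)
    then have "\<phi> t1 \<le> \<phi> r" using z(3) by simp
    then show False using r(1) m by auto
  qed
  then show ?thesis unfolding eventually_left_end_filter[OF ab] using s by blast
qed

section \<open>Derivatives and limits of the coefficients at 1\<close>

lemma C1_has_deriv:
  fixes w :: "real \<Rightarrow> real"
  assumes "w C1_differentiable_on S" "t \<in> S"
  shows "(w has_real_derivative deriv w t) (at t)"
proof -
  obtain D where "(w has_real_derivative D t) (at t)"
    using assms by (auto simp: C1_differentiable_on_def has_real_derivative_iff_has_vector_derivative)
  then show ?thesis using DERIV_imp_deriv by fastforce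
qed

lemma tendsto_at_left_1:
  assumes "continuous_on {0..1::real} k"
  shows "(k \<longlongrightarrow> k 1) (at_left 1)"
  using assms at_within_Icc_at_left[of 0 "1::real"]
  by (metis atLeastAtMost_iff continuous_on_def order_refl zero_le_one zero_less_one)

lemma affine_deriv: "((\<lambda>v. K * (1 - v)) has_real_derivative - K) (at v)" for K v :: real
  by (auto intro!: derivative_eq_intros)

lemma affine_tendsto: "((\<lambda>v. K * (1 - v)) \<longlongrightarrow> 0) (at_left 1)" for K :: real
  by (auto intro!: tendsto_eq_intros)

lemma eventually_at_left_1_unit: "\<forall>\<^sub>F v in at_left 1. v \<in> {0<..<1::real}"
  by (rule eventually_at_leftI[of 0]) auto

section \<open>The wave equation in flux form and strict monotonicity of the profile\<close>

locale wave_profile =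
  fixes p c :: real and f g \<rho> d u :: "real \<Rightarrow> real" and \<alpha> \<beta> :: ereal
  assumes std: "standing_assumptions p f g \<rho> d"
    and wave: "traveling_wave p f g \<rho> d c \<alpha> \<beta> u"
begin

definition h :: "real \<Rightarrow> real" where "h v = c * g v - f v"

definition y :: "real \<Rightarrow> real" where "y t = - p_flux p d u t"

abbreviation F :: "real filter" where "F \<equiv> left_end_filter \<alpha>"

lemma p_gt_1: "p > 1"
  and \<rho>_pos: "v \<in> {0<..<1} \<Longrightarrow> \<rho> v > 0"
  and d_pos: "v \<in> {0<..<1} \<Longrightarrow> d v > 0"
  using std by (auto simp: standing_assumptions_def)

lemma d_deriv: "v \<in> {0<..<1} \<Longrightarrow> (d has_real_derivative deriv d v) (at v)"
  using std by (auto simp: standing_assumptions_def intro: C1_has_deriv)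

lemma \<alpha>_less_\<beta>: "\<alpha> < \<beta>"
  and u_range: "t \<in> einterval \<alpha> \<beta> \<Longrightarrow> u t \<in> {0<..<1}"
  and u_deriv: "t \<in> einterval \<alpha> \<beta> \<Longrightarrow> (u has_real_derivative deriv u t) (at t)"
  and flux_deriv: "t \<in> einterval \<alpha> \<beta> \<Longrightarrow>
    (p_flux p d u has_real_derivative - h (u t) * deriv u t - \<rho> (u t)) (at t)"
proof -
  show "\<alpha> < \<beta>" using wave by (simp add: traveling_wave_def)
  assume t: "t \<in> einterval \<alpha> \<beta>"
  then show "u t \<in> {0<..<1}" "(u has_real_derivative deriv u t) (at t)"
    using wave by (auto simp: traveling_wave_def intro: C1_has_deriv)
  have "(p_flux p d u has_real_derivative deriv (p_flux p d u) t) (at t)"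
    using wave t by (auto simp: traveling_wave_def intro: C1_has_deriv)
  moreover have "deriv (p_flux p d u) t = - h (u t) * deriv u t - \<rho> (u t)"
    using wave t by (auto simp: traveling_wave_def h_def algebra_simps)
  ultimately show "(p_flux p d u has_real_derivative - h (u t) * deriv u t - \<rho> (u t)) (at t)"
    by simp
qed

lemmas eventually_F = eventually_left_end_filter[OF \<alpha>_less_\<beta>]

lemma F_neq_bot: "F \<noteq> bot"
  using left_end_filter_neq_bot[OF \<alpha>_less_\<beta>] .

lemma eventually_F_einterval: "\<forall>\<^sub>F t in F. t \<in> einterval \<alpha> \<beta>"
proof -
  obtain s where "s \<in> einterval \<alpha> \<beta>"
    using \<alpha>_less_\<beta> ereal_dense2[of \<alpha> \<beta>] by (auto simp: einterval_def)
  then show ?thesis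
    unfolding eventually_F
    by (intro bexI[of _ s]) (auto simp: einterval_def intro: less_trans[of _ "ereal s"])
qed

lemma u_tendsto: "(u \<longlongrightarrow> 1) F" and y_tendsto: "(y \<longlongrightarrow> 0) F"
proof -
  show "(u \<longlongrightarrow> 1) F"
    using wave by (simp add: traveling_wave_def tendsto_compose_filtermap)
  have "(p_flux p d u \<longlongrightarrow> 0) F"
    using wave by (simp add: traveling_wave_def tendsto_compose_filtermap)
  from tendsto_minus[OF this] show "(y \<longlongrightarrow> 0) F" by (simp add: y_def[abs_def])
qed

text \<open>Since \<open>u < 1\<close> on the wave interval, the convergence to 1 is from the left;
  every property or limit at 1- can therefore be pulled back along \<open>u\<close>.\<close>

lemma u_at_left: "filterlim u (at_left 1) F"
  unfolding filterlim_at
proof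
  show "\<forall>\<^sub>F t in F. u t \<in> {..<1} \<and> u t \<noteq> 1"
    using eventually_F_einterval by eventually_elim (use u_range in force)
qed (rule u_tendsto)

lemma eventually_at_u: "eventually P (at_left 1) \<Longrightarrow> \<forall>\<^sub>F t in F. P (u t)"
  using u_at_left by (simp add: filterlim_iff)

lemma h_tendsto: "(h \<longlongrightarrow> h 1) (at_left 1)"
  unfolding h_def using std
  by (intro tendsto_at_left_1[where k = "\<lambda>v. c * g v - f v"])
    (auto simp: standing_assumptions_def intro!: continuous_intros)

lemma \<rho>_tendsto: "(\<rho> \<longlongrightarrow> 0) (at_left 1)"
  using std tendsto_at_left_1[of \<rho>] by (simp add: standing_assumptions_def)

text \<open>The flux has negative derivative at each of its zeros, so it stays negative once it is; and
  it is negative somewhere to the left of every point because \<open>u\<close> tends to its supremum at \<open>\<alpha>\<close>.\<close>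
lemma u_decreasing:
  assumes t: "t \<in> einterval \<alpha> \<beta>"
  shows "deriv u t < 0"
proof -
  let ?w = "p_flux p d u"
  \<comment> \<open>Where \<open>u'\<close> is nonzero it is multiplied by a positive factor, so
    flux and \<open>u'\<close> share their sign.\<close>
  have sgn: "?w x < 0 \<longleftrightarrow> deriv u x < 0" "?w x = 0 \<longleftrightarrow> deriv u x = 0" if "x \<in> einterval \<alpha> \<beta>" for x
    using d_pos[OF u_range[OF that]]
    by (auto simp: p_flux_def mult_less_0_iff zero_less_mult_iff)
  have "\<forall>\<^sub>F x in F. u t < u x"
    using u_tendsto by (rule order_tendstoD) (use u_range[OF t] in auto)
  moreover have "\<forall>\<^sub>F x in F. \<alpha> < ereal x \<and> x < t"
    unfolding eventually_F using t by blast
  ultimately obtain x where x: "u t < u x" "\<alpha> < ereal x" "x < t"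
    using eventually_happens'[OF F_neq_bot eventually_conj] by blast
  have seg: "z \<in> einterval \<alpha> \<beta>" if "x \<le> z" "z \<le> t" for z
    using that x(2) t less_le_trans[of \<alpha> "ereal x" "ereal z"] le_less_trans[of "ereal z" "ereal t" \<beta>]
    by (auto simp: einterval_def)
  \<comment> \<open>The profile drops from \<open>u x\<close> to \<open>u t\<close>, so the mean
    value theorem yields a point of negative slope before \<open>t\<close>.\<close>
  obtain r where r: "x < r" "r < t" "u t - u x = (t - x) * deriv u r"
    using MVT2[OF x(3), of u "deriv u"] u_deriv seg by auto
  have "(t - x) * deriv u r < 0" using x(1) r(3) by simp
  then have "deriv u r < 0" using x(3) by (simp add: mult_less_0_iff)
  then have wr: "?w r < 0" using sgn seg r by simp
  have "?w t < 0"
  proof (rule ccontr)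
    assume neg: "\<not> ?w t < 0"
    have segr: "z \<in> einterval \<alpha> \<beta>" if "r \<le> z" "z \<le> t" for z
      using seg that r by auto
    have cont: "continuous_on {r..t} ?w"
      by (rule DERIV_continuous_on, rule has_field_derivative_at_within, rule flux_deriv)
        (auto intro: segr)
    let ?S = "{z \<in> {r..t}. 0 \<le> ?w z}"
    have "closed ?S"
      using continuous_on_closed_Collect_le[OF continuous_on_const cont] by simp
    then have "compact ?S"
      by (auto simp: compact_eq_bounded_closed intro: bounded_subset[of "{r..t}"])
    moreover have "?S \<noteq> {}" using neg r by auto
    \<comment> \<open>\<open>s\<close> is the first point after \<open>r\<close> where the flux is
      nonnegative; by the intermediate value theorem the flux vanishes there.\<close>
    ultimately obtain s where s: "s \<in> ?S" "\<And>z. z \<in> ?S \<Longrightarrow> s \<le> z"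
      using compact_attains_inf[of ?S] by blast
    have rs: "r < s" "s \<le> t" using s(1) wr by (auto simp: less_le)
    have below: "?w z < 0" if "r \<le> z" "z < s" for z
      using s(2)[of z] that rs by force
    obtain z where z: "r \<le> z" "z \<le> s" "?w z = 0"
      using IVT'[of ?w r 0 s] wr s(1) rs continuous_on_subset[OF cont] by auto
    then have "z = s" using below by force
    with z(3) have "?w s = 0" by simp
    then have "deriv u s = 0" using sgn(2)[OF segr] rs by simp
    \<comment> \<open>At a zero of the flux the first-order term drops out and only -\<rho> < 0
      remains. The flux would then be positive just before \<open>s\<close>, where it is known to be
      negative.\<close>
    then have "(?w has_real_derivative - \<rho> (u s)) (at s)"
      using flux_deriv[OF segr, of s] rs by simp
    moreover have "- \<rho> (u s) < 0" using \<rho>_pos[OF u_range[OF segr]] rs by simp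
    ultimately obtain e where e: "e > 0" "\<And>k. 0 < k \<Longrightarrow> k < e \<Longrightarrow> ?w s < ?w (s - k)"
      using DERIV_neg_dec_left by blast
    \<comment> \<open>The step to the left stays within the range \<open>e\<close> of the local
      decrease and does not pass \<open>r\<close>.\<close>
    define k where "k = min (e / 2) (s - r)"
    have "0 < k" "k < e" "k \<le> s - r" using e(1) rs by (auto simp: k_def)
    then have "?w s < ?w (s - k)" "?w (s - k) < 0" using e(2) below by auto
    then show False using \<open>?w s = 0\<close> by simp
  qed
  then show ?thesis using sgn[OF t] by simp
qed

text \<open>As \<open>u' < 0\<close>, the flux equals -d(u) (-u')^(p-1), and the power p - 1 > 0 can
  be inverted.\<close>

lemma deriv_u_eq:
  assumes t: "t \<in> einterval \<alpha> \<beta>"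
  shows "deriv u t = - ((y t / d (u t)) powr (1 / (p - 1)))" and "y t > 0"
proof -
  have dp: "d (u t) > 0" and neg: "deriv u t < 0"
    using d_pos u_range u_decreasing t by auto
  have "(- deriv u t) powr (p - 1) = (- deriv u t) powr (p - 2) * (- deriv u t)"
    using neg powr_add[of "- deriv u t" "p - 2" 1] by simp
  then have y: "y t = d (u t) * (- deriv u t) powr (p - 1)"
    using neg by (simp add: y_def p_flux_def)
  then show "y t > 0" using dp neg by simp
  have "(y t / d (u t)) powr (1 / (p - 1)) = - deriv u t"
    using y dp neg p_gt_1 by (simp add: powr_powr)
  then show "deriv u t = - ((y t / d (u t)) powr (1 / (p - 1)))" by simp
qed

lemma y_deriv:
  "t \<in> einterval \<alpha> \<beta> \<Longrightarrow> (y has_real_derivative h (u t) * deriv u t + \<rho> (u t)) (at t)"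
  unfolding y_def[abs_def] using DERIV_minus[OF flux_deriv, of t] by (simp add: add.commute)

section \<open>Comparison of \<open>y\<close> with upper and lower barriers\<close>

lemma b_u_tendsto: "(b \<longlongrightarrow> 0) (at_left 1) \<Longrightarrow> ((\<lambda>t. b (u t)) \<longlongrightarrow> (0::real)) F"
  using filterlim_compose[OF _ u_at_left] .

lemma b_u_deriv:
  assumes "\<And>v. v \<in> {0<..<1} \<Longrightarrow> (b has_real_derivative b' v) (at v)" "t \<in> einterval \<alpha> \<beta>"
  shows "((\<lambda>t. b (u t)) has_real_derivative b' (u t) * deriv u t) (at t)"
  using DERIV_chain2[OF assms(1)[OF u_range] u_deriv] assms(2) by simp

text \<open>Write q = 1/(p-1). Where \<open>y > b(u)\<close>, monotonicity of the power gives -u'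
  \<ge> (b/d)^q, hence \<rho> \<le> \<rho> (d/b)^q (-u'). So (y - b(u))' = (h - b') u' + \<rho>
  \<le> u' (h - b' - \<rho> (d/b)^q) \<le> 0, and \<open>barrier_nonpos\<close> applies.\<close>

lemma upper_barrier:
  assumes der: "\<And>v. v \<in> {0<..<1} \<Longrightarrow> (b has_real_derivative b' v) (at v)"
    and pos: "\<And>v. v \<in> {0<..<1} \<Longrightarrow> b v > 0"
    and lim: "(b \<longlongrightarrow> 0) (at_left 1)"
    and super: "\<forall>\<^sub>F v in at_left 1. h v - b' v - \<rho> v * (d v / b v) powr (1 / (p - 1)) > 0"
  shows "\<forall>\<^sub>F t in F. y t \<le> b (u t)"
proof -
  have "\<forall>\<^sub>F t in F. y t - b (u t) \<le> 0"
  proof (rule barrier_nonpos[OF \<alpha>_less_\<beta>])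
    show "((\<lambda>t. y t - b (u t)) \<longlongrightarrow> 0) F"
      using tendsto_diff[OF y_tendsto b_u_tendsto[OF lim]] by simp
    show "\<forall>\<^sub>F t in F. ((\<lambda>t. y t - b (u t)) has_real_derivative
        h (u t) * deriv u t + \<rho> (u t) - b' (u t) * deriv u t) (at t)"
      using eventually_F_einterval
      by eventually_elim (intro DERIV_diff y_deriv b_u_deriv der)
    show "\<forall>\<^sub>F t in F. 0 < y t - b (u t) \<longrightarrow>
        h (u t) * deriv u t + \<rho> (u t) - b' (u t) * deriv u t \<le> 0"
      using eventually_F_einterval eventually_at_u[OF super]
    proof eventually_elim
      case (elim t)
      show ?case
      proof
        assume gt: "0 < y t - b (u t)"
        let ?q = "1 / (p - 1)" and ?v = "u t"
        have v: "?v \<in> {0<..<1}" using u_range elim by blast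
        note bd = pos[OF v] d_pos[OF v] \<rho>_pos[OF v]
        have "(b ?v / d ?v) powr ?q \<le> (y t / d ?v) powr ?q"
          using gt bd p_gt_1 by (intro powr_mono2 divide_right_mono) auto
        then have "(b ?v / d ?v) powr ?q \<le> - deriv u t"
          using deriv_u_eq(1)[OF elim(1)] by simp
        then have "(d ?v / b ?v) powr ?q * (b ?v / d ?v) powr ?q \<le> (d ?v / b ?v) powr ?q * - deriv u t"
          by (rule mult_left_mono) simp
        moreover have "(d ?v / b ?v) powr ?q * (b ?v / d ?v) powr ?q = 1"
          using bd by (simp flip: powr_mult)
        ultimately have "1 \<le> (d ?v / b ?v) powr ?q * - deriv u t" by simp
        then have "\<rho> ?v * 1 \<le> \<rho> ?v * ((d ?v / b ?v) powr ?q * - deriv u t)"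
          using bd by (intro mult_left_mono) auto
        moreover have "deriv u t * (h ?v - b' ?v - \<rho> ?v * (d ?v / b ?v) powr ?q) \<le> 0"
          using elim u_decreasing by (intro mult_nonpos_nonneg) (auto simp: less_imp_le)
        ultimately show "h ?v * deriv u t + \<rho> ?v - b' ?v * deriv u t \<le> 0"
          by (simp add: algebra_simps)
      qed
    qed
  qed
  then show ?thesis by eventually_elim simp
qed

text \<open>Here (b(u) - y)' = u' (b' - h) - \<rho>, and both terms are nonpositive near the left
  end because \<open>u' < 0\<close> and \<open>\<rho> > 0\<close>.\<close>

lemma lower_barrier:
  assumes der: "\<And>v. v \<in> {0<..<1} \<Longrightarrow> (b has_real_derivative b' v) (at v)"
    and lim: "(b \<longlongrightarrow> 0) (at_left 1)"
    and sub: "\<forall>\<^sub>F v in at_left 1. b' v - h v > 0"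
  shows "\<forall>\<^sub>F t in F. b (u t) \<le> y t"
proof -
  have "\<forall>\<^sub>F t in F. b (u t) - y t \<le> 0"
  proof (rule barrier_nonpos[OF \<alpha>_less_\<beta>])
    show "((\<lambda>t. b (u t) - y t) \<longlongrightarrow> 0) F"
      using tendsto_diff[OF b_u_tendsto[OF lim] y_tendsto] by simp
    show "\<forall>\<^sub>F t in F. ((\<lambda>t. b (u t) - y t) has_real_derivative
        b' (u t) * deriv u t - (h (u t) * deriv u t + \<rho> (u t))) (at t)"
      using eventually_F_einterval
      by eventually_elim (intro DERIV_diff y_deriv b_u_deriv der)
    show "\<forall>\<^sub>F t in F. 0 < b (u t) - y t \<longrightarrow>
        b' (u t) * deriv u t - (h (u t) * deriv u t + \<rho> (u t)) \<le> 0"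
      using eventually_F_einterval eventually_at_u[OF sub]
    proof eventually_elim
      case (elim t)
      have "deriv u t * (b' (u t) - h (u t)) \<le> 0"
        using elim u_decreasing by (intro mult_nonpos_nonneg) (auto simp: less_imp_le)
      then show ?case using \<rho>_pos[OF u_range[OF elim(1)]] by (auto simp: algebra_simps)
    qed
  qed
  then show ?thesis by eventually_elim simp
qed

text \<open>For b = K (1 - v) the constant \<open>K\<close> splits off the power, and the expression
  in \<open>upper_barrier\<close> converges to the left side of \<open>ineq\<close>. A positive
  limit gives the strict inequality near 1.\<close>

lemma affine_upper:
  assumes K: "K > 0"
    and lim: "((\<lambda>v. \<rho> v * (d v / (1 - v)) powr (1 / (p - 1))) \<longlongrightarrow> L) (at_left 1)"
    and ineq: "h 1 + K - L / K powr (1 / (p - 1)) > 0"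
  shows "\<forall>\<^sub>F t in F. y t \<le> K * (1 - u t)"
proof (rule upper_barrier[where b' = "\<lambda>_. - K"])
  let ?q = "1 / (p - 1)"
  have "((\<lambda>v. h v + K - \<rho> v * (d v / (1 - v)) powr ?q / K powr ?q) \<longlongrightarrow>
      h 1 + K - L / K powr ?q) (at_left 1)"
    by (intro tendsto_intros h_tendsto lim) (use K in auto)
  from order_tendstoD(1)[OF this ineq]
  have "\<forall>\<^sub>F v in at_left 1. 0 < h v + K - \<rho> v * (d v / (1 - v)) powr ?q / K powr ?q" .
  then show "\<forall>\<^sub>F v in at_left 1. 0 < h v - - K - \<rho> v * (d v / (K * (1 - v))) powr ?q"
    using eventually_at_left_1_unit
  proof eventually_elim
    case (elim v)
    have "(d v / (K * (1 - v))) powr ?q = (d v / (1 - v)) powr ?q / K powr ?q"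
      using K d_pos elim(2) powr_divide[of "d v / (1 - v)" K ?q] by (simp add: mult.commute)
    then show ?case using elim(1) by simp
  qed
qed (use K affine_deriv affine_tendsto in auto)

lemma affine_lower:
  assumes "K < - h 1"
  shows "\<forall>\<^sub>F t in F. K * (1 - u t) \<le> y t"
proof (rule lower_barrier[where b' = "\<lambda>_. - K"])
  have "((\<lambda>v. - K - h v) \<longlongrightarrow> - K - h 1) (at_left 1)"
    by (intro tendsto_intros h_tendsto)
  from order_tendstoD(1)[OF this, of 0] assms show "\<forall>\<^sub>F v in at_left 1. 0 < - K - h v" by simp
qed (use affine_deriv affine_tendsto in auto)

section \<open>Limits of \<open>u'\<close> from the behaviour of \<open>y / d\<close>, case by
  case\<close>

lemma deriv_u_tendsto:
  assumes "((\<lambda>t. y t / d (u t)) \<longlongrightarrow> L) F"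
  shows "(deriv u \<longlongrightarrow> - (L powr (1 / (p - 1)))) F"
proof -
  \<comment> \<open>The limit \<open>L\<close> may be 0; nonnegativity of the quotient and the
    positive exponent give convergence of the powers in that case too.\<close>
  have "\<forall>\<^sub>F t in F. 0 \<le> y t / d (u t)"
    using eventually_F_einterval
    by eventually_elim (use deriv_u_eq(2) d_pos u_range in \<open>simp add: less_imp_le\<close>)
  then have "((\<lambda>t. - ((y t / d (u t)) powr (1 / (p - 1)))) \<longlongrightarrow> - (L powr (1 / (p - 1)))) F"
    using p_gt_1 by (intro tendsto_minus tendsto_powr2 assms tendsto_const) auto
  then show ?thesis
    by (rule Lim_transform_eventually)
      (use eventually_F_einterval in eventually_elim, simp add: deriv_u_eq(1))
qed

lemma deriv_u_tendsto_0:
  "((\<lambda>t. y t / d (u t)) \<longlongrightarrow> 0) F \<Longrightarrow> (deriv u \<longlongrightarrow> 0) F"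
  using deriv_u_tendsto[of 0] by simp

lemma deriv_u_at_bot:
  assumes "filterlim (\<lambda>t. y t / d (u t)) at_top F"
  shows "filterlim (deriv u) at_bot F"
proof -
  have "filterlim (\<lambda>t. (y t / d (u t)) powr (1 / (p - 1))) at_top F"
    using p_gt_1 by (intro filterlim_compose[OF real_powr_at_top assms]) auto
  then have "filterlim (\<lambda>t. - ((y t / d (u t)) powr (1 / (p - 1)))) at_bot F"
    by (simp add: filterlim_uminus_at_bot)
  then show ?thesis
    by (rule filterlim_mono_eventually[OF _ order_refl order_refl])
      (use eventually_F_einterval in eventually_elim, simp add: deriv_u_eq(1))
qed

text \<open>A positive lower bound \<open>m\<close> for \<open>d\<close> near 1 gives 0 < y/d \<le>
  y/m, and \<open>y\<close> tends to 0.\<close>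

lemma deriv_u_lim_liminf_pos:
  assumes "Liminf (at_left 1) (\<lambda>v. ereal (d v)) > 0"
  shows "(deriv u \<longlongrightarrow> 0) F"
proof -
  obtain m where m: "0 < ereal m" "ereal m < Liminf (at_left 1) (\<lambda>v. ereal (d v))"
    using assms ereal_dense2 by blast
  show ?thesis
  proof (rule deriv_u_tendsto_0, rule Lim_null_comparison)
    have "\<forall>\<^sub>F t in F. ereal m < ereal (d (u t))"
      using eventually_at_u[OF less_LiminfD[OF m(2)]] .
    with eventually_F_einterval show "\<forall>\<^sub>F t in F. norm (y t / d (u t)) \<le> y t / m"
    proof eventually_elim
      case (elim t)
      then have "y t / d (u t) \<le> y t / m"
        using m(1) deriv_u_eq(2)[of t] by (intro divide_left_mono) auto
      then show ?case using elim m(1) deriv_u_eq(2)[of t] by auto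
    qed
    show "((\<lambda>t. y t / m) \<longlongrightarrow> 0) F"
      using tendsto_divide[OF y_tendsto tendsto_const, of m] m(1) by simp
  qed
qed

text \<open>A single affine upper bound y \<le> K (1 - u) is enough: dividing by \<open>d\<close>
  leaves K / (d / (1 - u)), whose denominator tends to infinity.\<close>

lemma deriv_u_lim_infinite_slope:
  assumes slope: "has_slope_at_1 d (-\<infinity>)"
    and l1: "((\<lambda>v. ereal (\<rho> v * (d v / (1 - v)) powr (1 / (p - 1)))) \<longlongrightarrow> l1) (at_left 1)"
    and fin: "l1 < \<infinity>"
  shows "(deriv u \<longlongrightarrow> 0) F"
proof -
  let ?q = "1 / (p - 1)"
  have "\<forall>\<^sub>F v in at_left 1. 0 \<le> ereal (\<rho> v * (d v / (1 - v)) powr ?q)"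
    using eventually_at_left_1_unit by eventually_elim (simp add: \<rho>_pos less_imp_le)
  then have "0 \<le> l1"
    using tendsto_lowerbound[OF l1] by simp
  with fin obtain L where L: "l1 = ereal L" "0 \<le> L" by (cases l1) auto
  have lim: "((\<lambda>v. \<rho> v * (d v / (1 - v)) powr ?q) \<longlongrightarrow> L) (at_left 1)"
    using l1 unfolding L(1) by simp
  \<comment> \<open>With \<open>K \<ge> 1\<close> the quotient of \<open>L\<close> by the power of
    \<open>K\<close> is at most \<open>L\<close>, so the quantity required by
    \<open>affine_upper\<close> is at least 1 + h 1 + |h 1| > 0.\<close>
  define K where "K = 1 + L + \<bar>h 1\<bar>"
  have K: "1 \<le> K" using L by (simp add: K_def)
  then have "1 \<le> K powr ?q" using p_gt_1 by (simp add: ge_one_powr_ge_zero)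
  then have "L / K powr ?q \<le> L" using L by (simp add: divide_le_eq mult_left_le mult_le_cancel_left1)
  then have "h 1 + K - L / K powr ?q > 0" by (auto simp: K_def)
  then have up: "\<forall>\<^sub>F t in F. y t \<le> K * (1 - u t)"
    using affine_upper[OF _ lim] K by simp
  have top: "filterlim (\<lambda>v. d v / (1 - v)) at_top (at_left 1)"
    unfolding filterlim_at_top_dense
  proof
    fix r
    have "\<forall>\<^sub>F v in at_left 1. ereal (- d v / (1 - v)) < ereal (- r)"
      using slope unfolding has_slope_at_1_def tendsto_MInfty by blast
    then show "\<forall>\<^sub>F v in at_left 1. r < d v / (1 - v)" by eventually_elim simp
  qed
  show ?thesis
  proof (rule deriv_u_tendsto_0, rule Lim_null_comparison)
    show "\<forall>\<^sub>F t in F. norm (y t / d (u t)) \<le> K / (d (u t) / (1 - u t))"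
      using eventually_F_einterval up
    proof eventually_elim
      case (elim t)
      then show ?case
        using deriv_u_eq(2)[of t] d_pos[OF u_range[of t]] by (simp add: divide_right_mono)
    qed
    show "((\<lambda>t. K / (d (u t) / (1 - u t))) \<longlongrightarrow> 0) F"
      by (rule tendsto_divide_0[OF tendsto_const])
        (rule filterlim_at_top_imp_at_infinity[OF filterlim_compose[OF top u_at_left]])
  qed
qed

text \<open>Since d / (1 - v) has a finite limit and \<rho> tends to 0, \<open>affine_upper\<close>
  applies with limit 0 for every positive K > -h 1. Together with \<open>affine_lower\<close> and y
  > 0 this squeezes y / (1 - u) to max 0 (-h 1); division by d / (1 - u), which tends to -D, gives y
  / d.\<close>

lemma deriv_u_lim_finite_slope:
  assumes slope: "has_slope_at_1 d (ereal D)" and D: "D < 0"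
  shows "(deriv u \<longlongrightarrow> - (max 0 (h 1 / D) powr (1 / (p - 1)))) F"
proof -
  let ?q = "1 / (p - 1)"
  have "((\<lambda>v. - d v / (1 - v)) \<longlongrightarrow> D) (at_left 1)"
    using slope by (simp add: has_slope_at_1_def)
  from tendsto_minus[OF this] have dq: "((\<lambda>v. d v / (1 - v)) \<longlongrightarrow> - D) (at_left 1)" by simp
  have "((\<lambda>v. \<rho> v * (d v / (1 - v)) powr ?q) \<longlongrightarrow> 0 * (- D) powr ?q) (at_left 1)"
    by (intro tendsto_intros \<rho>_tendsto dq) (use D in auto)
  then have lim: "((\<lambda>v. \<rho> v * (d v / (1 - v)) powr ?q) \<longlongrightarrow> 0) (at_left 1)" by simp
  have "((\<lambda>t. y t / (1 - u t)) \<longlongrightarrow> max 0 (- h 1)) F"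
  proof (rule order_tendstoI)
    fix a assume a: "a < max 0 (- h 1)"
    show "\<forall>\<^sub>F t in F. a < y t / (1 - u t)"
    \<comment> \<open>Below 0 positivity of \<open>y\<close> suffices; for a \<ge> 0 the maximum
      must be -h 1, which leaves room for an affine lower barrier.\<close>
    proof (cases "a < 0")
      case True
      show ?thesis
        using eventually_F_einterval
      proof eventually_elim
        case (elim t)
        have "0 < y t / (1 - u t)" using deriv_u_eq(2)[OF elim] u_range[OF elim] by simp
        with True show ?case by linarith
      qed
    next
      case False
      with a have "a < - h 1" by simp
      then obtain K where K: "a < K" "K < - h 1" using dense by blast
      show ?thesis
        using eventually_F_einterval affine_lower[OF K(2)]
      proof eventually_elim
        case (elim t)
        then have "K \<le> y t / (1 - u t)" using u_range[of t] by (simp add: le_divide_eq)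
        with K(1) show ?case by linarith
      qed
    qed
  next
    fix a assume "max 0 (- h 1) < a"
    then obtain K where K: "max 0 (- h 1) < K" "K < a" using dense by blast
    then have "\<forall>\<^sub>F t in F. y t \<le> K * (1 - u t)"
      using affine_upper[OF _ lim] by simp
    with eventually_F_einterval show "\<forall>\<^sub>F t in F. y t / (1 - u t) < a"
    proof eventually_elim
      case (elim t)
      then have "y t / (1 - u t) \<le> K" using u_range[of t] by (simp add: divide_le_eq)
      with K(2) show ?case by linarith
    qed
  qed
  then have "((\<lambda>t. y t / (1 - u t) / (d (u t) / (1 - u t))) \<longlongrightarrow> max 0 (- h 1) / (- D)) F"
    using D filterlim_compose[OF dq u_at_left] by (intro tendsto_divide) auto
  moreover have "max 0 (- h 1) / (- D) = max 0 (h 1 / D)"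
    using D by (auto simp: max_def field_simps)
  ultimately have "((\<lambda>t. y t / (1 - u t) / (d (u t) / (1 - u t))) \<longlongrightarrow> max 0 (h 1 / D)) F"
    by simp
  then have "((\<lambda>t. y t / d (u t)) \<longlongrightarrow> max 0 (h 1 / D)) F"
  proof (rule Lim_transform_eventually)
    show "\<forall>\<^sub>F t in F. y t / (1 - u t) / (d (u t) / (1 - u t)) = y t / d (u t)"
      using eventually_F_einterval by eventually_elim (use u_range in fastforce)
  qed
  then show ?thesis by (rule deriv_u_tendsto)
qed

lemma scaled_d_deriv:
  "v \<in> {0<..<1} \<Longrightarrow> ((\<lambda>v. K * d v) has_real_derivative K * deriv d v) (at v)"
  using DERIV_cmult[OF d_deriv] .

lemma scaled_d_tendsto:
  "(d \<longlongrightarrow> 0) (at_left 1) \<Longrightarrow> ((\<lambda>v. K * d v) \<longlongrightarrow> 0) (at_left 1)"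
  using tendsto_mult_right_zero .

text \<open>For b = K d the ratio d / b is the constant 1 / K, so the expression in
  \<open>upper_barrier\<close> tends to \<open>h 1 > 0\<close> for every \<open>K > 0\<close>. Hence
  y / d is eventually below any positive bound.\<close>

lemma deriv_u_lim_zero_slope_pos:
  assumes d0: "(d \<longlongrightarrow> 0) (at_left 1)" and d'0: "(deriv d \<longlongrightarrow> 0) (at_left 1)" and pos: "h 1 > 0"
  shows "(deriv u \<longlongrightarrow> 0) F"
proof (rule deriv_u_tendsto_0, rule order_tendstoI)
  fix a :: real assume "a < 0"
  show "\<forall>\<^sub>F t in F. a < y t / d (u t)"
    using eventually_F_einterval
  proof eventually_elim
    case (elim t)
    have "0 < y t / d (u t)" using deriv_u_eq(2)[OF elim] d_pos[OF u_range[OF elim]] by simp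
    with \<open>a < 0\<close> show ?case by linarith
  qed
next
  fix a :: real assume "0 < a"
  then obtain K where K: "0 < K" "K < a" using dense by blast
  let ?q = "1 / (p - 1)"
  have "\<forall>\<^sub>F t in F. y t \<le> K * d (u t)"
  proof (rule upper_barrier[OF scaled_d_deriv _ scaled_d_tendsto[OF d0]])
    have "((\<lambda>v. h v - K * deriv d v - \<rho> v * (1 / K) powr ?q) \<longlongrightarrow>
        h 1 - K * 0 - 0 * (1 / K) powr ?q) (at_left 1)"
      by (intro tendsto_intros h_tendsto d'0 \<rho>_tendsto)
    from order_tendstoD(1)[OF this, of 0] pos
    have "\<forall>\<^sub>F v in at_left 1. 0 < h v - K * deriv d v - \<rho> v * (1 / K) powr ?q" by simp
    then show "\<forall>\<^sub>F v in at_left 1. 0 < h v - K * deriv d v - \<rho> v * (d v / (K * d v)) powr ?q"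
      using eventually_at_left_1_unit
    proof eventually_elim
      case (elim v)
      have "d v / (K * d v) = 1 / K" using d_pos[OF elim(2)] by simp
      with elim(1) show ?case by simp
    qed
  qed (use K d_pos in auto)
  with eventually_F_einterval show "\<forall>\<^sub>F t in F. y t / d (u t) < a"
  proof eventually_elim
    case (elim t)
    then have "y t / d (u t) \<le> K" using d_pos[OF u_range[of t]] by (simp add: divide_le_eq)
    with K(2) show ?case by linarith
  qed
qed

text \<open>For b = K d the difference b' - h tends to -h 1 > 0 whatever \<open>K\<close> is, so y /
  d eventually exceeds every constant.\<close>

lemma deriv_u_lim_zero_slope_neg:
  assumes d0: "(d \<longlongrightarrow> 0) (at_left 1)" and d'0: "(deriv d \<longlongrightarrow> 0) (at_left 1)" and neg: "h 1 < 0"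
  shows "filterlim (deriv u) at_bot F"
proof (rule deriv_u_at_bot, unfold filterlim_at_top, rule allI)
  fix K :: real
  have "\<forall>\<^sub>F t in F. K * d (u t) \<le> y t"
  proof (rule lower_barrier[OF scaled_d_deriv scaled_d_tendsto[OF d0]])
    have "((\<lambda>v. K * deriv d v - h v) \<longlongrightarrow> K * 0 - h 1) (at_left 1)"
      by (intro tendsto_intros h_tendsto d'0)
    from order_tendstoD(1)[OF this, of 0] neg
    show "\<forall>\<^sub>F v in at_left 1. 0 < K * deriv d v - h v" by simp
  qed
  with eventually_F_einterval show "\<forall>\<^sub>F t in F. K \<le> y t / d (u t)"
    by eventually_elim (use d_pos u_range in \<open>simp add: le_divide_eq\<close>)
qed

end

section \<open>Assembly of the four cases at the left endpoint\<close>

theorem theorem20: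
  fixes p c :: real
    and f g \<rho> d u :: "real \<Rightarrow> real"
    and l1 \<alpha> \<beta> :: ereal
  assumes "standing_assumptions p f g \<rho> d"
    and "((\<lambda>v. ereal (\<rho> v * (d v / (1 - v)) powr (1 / (p - 1)))) \<longlongrightarrow> l1) (at_left 1)"
    and "traveling_wave p f g \<rho> d c \<alpha> \<beta> u"
  shows
    "(Liminf (at_left 1) (\<lambda>v. ereal (d v)) > 0 \<longrightarrow>
        ((deriv u \<circ> real_of_ereal) \<longlongrightarrow> 0) (at_right \<alpha>)) \<and>
     ((d \<longlongrightarrow> 0) (at_left 1) \<and> has_slope_at_1 d (-\<infinity>) \<and> l1 < \<infinity> \<longrightarrow>
        ((deriv u \<circ> real_of_ereal) \<longlongrightarrow> 0) (at_right \<alpha>)) \<and>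
     (\<forall>D::real. (d \<longlongrightarrow> 0) (at_left 1) \<and> has_slope_at_1 d (ereal D) \<and> D < 0 \<longrightarrow>
        ((deriv u \<circ> real_of_ereal) \<longlongrightarrow>
           - ((max 0 ((c * g 1 - f 1) / D)) powr (1 / (p - 1)))) (at_right \<alpha>)) \<and>
     ((d \<longlongrightarrow> 0) (at_left 1) \<and> (deriv d \<longlongrightarrow> 0) (at_left 1) \<and> c * g 1 - f 1 \<noteq> 0 \<longrightarrow>
        (c * g 1 - f 1 > 0 \<longrightarrow> ((deriv u \<circ> real_of_ereal) \<longlongrightarrow> 0) (at_right \<alpha>)) \<and>
        (c * g 1 - f 1 < 0 \<longrightarrow> filterlim (deriv u \<circ> real_of_ereal) at_bot (at_right \<alpha>)))"
proof -
  interpret wave_profile p c f g \<rho> d u \<alpha> \<beta>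
    using assms(1,3) by unfold_locales
  show ?thesis
    using deriv_u_lim_liminf_pos deriv_u_lim_infinite_slope[OF _ assms(2)] deriv_u_lim_finite_slope
      deriv_u_lim_zero_slope_pos deriv_u_lim_zero_slope_neg
    \<comment> \<open>\<open>filterlim_filtermap\<close> turns limits along \<open>F\<close> into
      limits of compositions with \<open>real_of_ereal\<close> at \<open>\<alpha>\<close>.\<close>
    unfolding h_def filterlim_filtermap comp_def by blast
qed

end
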